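(* The total area of the disks tangent to the great circle in the Apollonian Window (i.e. of the corona of its disk of curvature $-1$) is $$A=\frac{\pi}{2}\sum_{\substack{m,n\in\mathbb Z\\ \gcd(m,n)=1}}\frac{1}{\big(m^2+n^2+1\big)^2},$$ where $(m,n)$ runs over all pairs of coprime integers (including negative ones).
   Context: The Apollonian Window is the Apollonian disk packing generated by the exterior of the unit circle centered at the origin (regarded as a disk of curvature $-1$; the unit circle is the "great circle") and the two disks of radius $1/2$ centered at $(\pm\frac12,0)$: starting from these three mutually tangent disks (disjoint interiors, tangent boundaries), one repeatedly adjoins, for every three mutually tangent disks already present, both disks that are tangent to all three. The corona of a disk in the packing is the set of all disks of the packing tangent to it; the corona of the exterior disk consists of the disks of the packing touching the unit circle from inside. The pairs $(\pm1,0)$ and $(0,\pm1)$ are coprime. *)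

theory Defs
  imports "HOL-Analysis.Analysis"
begin

text \<open>Generalized closed disks of the plane: round disks, exteriors of round disks (negative
  curvature), and half-planes (curvature 0).\<close>

definition is_disk :: "complex set \<Rightarrow> bool" where
  "is_disk D \<longleftrightarrow>
     (\<exists>c r. 0 < r \<and> D = cball c r) \<or>
     (\<exists>c r. 0 < r \<and> D = - ball c r) \<or>
     (\<exists>u t. u \<noteq> 0 \<and> D = {z. u \<bullet> z \<le> t})"

text \<open>The boundary circle in the Riemann sphere; \<open>None\<close> is the point at infinity, which lies on
  the boundary exactly when the boundary is a line.\<close>

definition boundary_circle :: "complex set \<Rightarrow> complex option set" where
  "boundary_circle D = Some ` frontier D \<union> (if bounded (frontier D) then {} else {None})"

definition tangent_disks :: "complex set \<Rightarrow> complex set \<Rightarrow> bool" where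
  "tangent_disks D E \<longleftrightarrow>
     interior D \<inter> interior E = {} \<and> (\<exists>p. boundary_circle D \<inter> boundary_circle E = {p})"

inductive_set apollonian_packing :: "complex set set \<Rightarrow> complex set set"
  for S :: "complex set set" where
  initial: "D \<in> S \<Longrightarrow> D \<in> apollonian_packing S"
| adjoin: "\<lbrakk>D1 \<in> apollonian_packing S; D2 \<in> apollonian_packing S; D3 \<in> apollonian_packing S;
            tangent_disks D1 D2; tangent_disks D1 D3; tangent_disks D2 D3;
            is_disk D; tangent_disks D D1; tangent_disks D D2; tangent_disks D D3\<rbrakk>
           \<Longrightarrow> D \<in> apollonian_packing S"

definition great_disk :: "complex set" where
  "great_disk = - ball 0 1"

definition apollonian_window :: "complex set set" where
  "apollonian_window =
     apollonian_packing {great_disk, cball (Complex (1/2) 0) (1/2), cball (Complex (-1/2) 0) (1/2)}"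

definition corona :: "complex set set \<Rightarrow> complex set \<Rightarrow> complex set set" where
  "corona P D = {E \<in> P. tangent_disks D E}"

end

theory Submission
  imports Defs
begin

text \<open>
  A disk is a vector of norm 1 for the Lorentz form, and two disks are tangent with disjoint
  interiors precisely when their product is \<open>-1\<close>.  In coordinates with respect to the
  Descartes quadruple formed by the three initial disks and the disk of curvature 3 above them,
  the form is \<open>2 \<Sum>x\<^sub>iy\<^sub>i - (\<Sum>x\<^sub>i)(\<Sum>y\<^sub>i)\<close>, and the packing is the orbit of the four unit vectors
  under the reflections in the four circles through the tangency points of three of these disks.
  Every vector of the orbit other than a unit vector has exactly one negative coordinate, and
  reflecting there shortens it.  This descent moves any three mutually tangent disks
  to three unit vectors, where the two disks tangent to all three are read off.

  The disks tangent to the great circle are reached by the three reflections that fix it.  These act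
  on pairs \<open>\<plusminus>(m, n)\<close> of coprime integers by \<open>(m, 2m - n)\<close>, \<open>(2n - m, n)\<close> and \<open>(m, -n)\<close>,
  the disk of \<open>\<plusminus>(m, n)\<close> having curvature \<open>m\<^sup>2 + n\<^sup>2 + 1\<close> and center \<open>(m + i n)\<^sup>2 / (m\<^sup>2 + n\<^sup>2 + 1)\<close>.
\<close>

section \<open>The orbit of the Descartes quadruple\<close>

definition descartes_form :: "(4 \<Rightarrow> real) \<Rightarrow> (4 \<Rightarrow> real) \<Rightarrow> real" where
  "descartes_form x y = 2 * (\<Sum>i\<in>UNIV. x i * y i) - (\<Sum>i\<in>UNIV. x i) * (\<Sum>i\<in>UNIV. y i)"

text \<open>The inversion in the circle through the tangency points of the other three disks: it
  fixes these and swaps \<open>coord k\<close> with the second disk tangent to them, whose vector is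
  twice their sum minus \<open>coord k\<close>.\<close>

definition reflect :: "4 \<Rightarrow> (4 \<Rightarrow> real) \<Rightarrow> 4 \<Rightarrow> real" where
  "reflect k x = (\<lambda>i. if i = k then - x k else x i + 2 * x k)"

definition coord :: "4 \<Rightarrow> 4 \<Rightarrow> real" where
  "coord i = (\<lambda>j. if j = i then 1 else 0)"

lemma coord_simps [simp]: "coord i i = 1" "j \<noteq> i \<Longrightarrow> coord i j = 0"
  by (simp_all add: coord_def)

lemma sum_coord [simp]: "(\<Sum>j\<in>UNIV. coord i j) = 1"
  by (simp add: coord_def)

lemma descartes_form_commute: "descartes_form x y = descartes_form y x"
  by (simp add: descartes_form_def mult.commute)

lemma descartes_form_coord: "descartes_form (coord i) x = 2 * x i - (\<Sum>j\<in>UNIV. x j)"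
proof -
  have "(\<Sum>j\<in>UNIV. coord i j * x j) = (\<Sum>j\<in>UNIV. if j = i then x j else 0)"
    by (intro sum.cong) (auto simp: coord_def)
  then show ?thesis by (simp add: descartes_form_def)
qed

lemma descartes_form_coord_coord: "descartes_form (coord i) (coord j) = (if i = j then 1 else -1)"
  unfolding descartes_form_coord by (simp add: coord_def)

lemma reflect_reflect [simp]: "reflect k (reflect k x) = x"
  by (auto simp: reflect_def)

lemma reflect_eq_self: "x k = 0 \<Longrightarrow> reflect k x = x"
  by (auto simp: reflect_def)

lemma reflect_coord: "k \<noteq> i \<Longrightarrow> reflect k (coord i) = coord i"
  by (simp add: reflect_eq_self)

lemma sum_reflect: "(\<Sum>i\<in>UNIV. reflect k x i) = (\<Sum>i\<in>UNIV. x i) + 4 * x k"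
  using exhaust_4[of k] by (auto simp: sum_4 reflect_def)

text \<open>Self-adjointness; as \<open>reflect k\<close> is an involution, this also makes it an
  isometry.\<close>

lemma descartes_form_reflect: "descartes_form (reflect k x) y = descartes_form x (reflect k y)"
  using exhaust_4[of k] by (auto simp: sum_4 reflect_def descartes_form_def algebra_simps)

lemma descartes_form_reflect_reflect:
  "descartes_form (reflect k x) (reflect k y) = descartes_form x y"
  by (simp add: descartes_form_reflect)

text \<open>Only reflections in positive coordinates are admitted, which makes rule induction the descent
  argument; closure under all reflections is lemma \<open>orbit_reflect_closed\<close>.\<close>

inductive_set orbit :: "(4 \<Rightarrow> real) set" where
  coord: "coord i \<in> orbit"
| reflect: "x \<in> orbit \<Longrightarrow> 0 < x k \<Longrightarrow> reflect k x \<in> orbit"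

section \<open>Invariants of the orbit and its closure under reflections\<close>

lemma orbit_norm: "x \<in> orbit \<Longrightarrow> descartes_form x x = 1"
  by (induction rule: orbit.induct)
    (simp_all add: descartes_form_coord_coord descartes_form_reflect_reflect)

lemma orbit_sum_ge: "x \<in> orbit \<Longrightarrow> 1 \<le> (\<Sum>i\<in>UNIV. x i)"
  by (induction rule: orbit.induct) (simp_all add: sum_reflect)

text \<open>The negative coordinate is the one reflected in last. The bound
  \<open>- x j \<le> x k\<close> keeps the induction going: the new entry
  \<open>x j + 2 * x k\<close> is then at least \<open>x k\<close>, hence positive.\<close>

lemma orbit_signs:
  "x \<in> orbit \<Longrightarrow> (\<exists>i. x = coord i) \<or> (\<exists>j. x j < 0 \<and> (\<forall>k. k \<noteq> j \<longrightarrow> - x j \<le> x k))"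
proof (induction rule: orbit.induct)
  case (reflect x k)
  from reflect.IH show ?case
  proof
    assume "\<exists>i. x = coord i"
    then have "x = coord k" using reflect.hyps by (auto simp: coord_def split: if_splits)
    then show ?thesis
      by (intro disjI2 exI[of _ k]) (auto simp: reflect_def)
  next
    assume "\<exists>j. x j < 0 \<and> (\<forall>k. k \<noteq> j \<longrightarrow> - x j \<le> x k)"
    then obtain j where j: "x j < 0" "\<And>k. k \<noteq> j \<Longrightarrow> - x j \<le> x k" by auto
    have "j \<noteq> k" using j reflect.hyps by auto
    have "x k \<le> x i + 2 * x k" if "i \<noteq> k" for i
      using j(1) j(2)[of i] j(2)[of k] \<open>j \<noteq> k\<close> reflect.hyps by (cases "i = j") auto
    then show ?thesis using reflect.hyps
      by (intro disjI2 exI[of _ k]) (auto simp: reflect_def)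
  qed
qed auto

text \<open>A reflection in \<open>k \<noteq> i\<close> fixes \<open>coord i\<close> and keeps the
  product; one in \<open>k = i\<close> gives \<open>- 6 * x k\<close> minus the coordinate sum of
  \<open>x\<close>, and that sum is at least 1.\<close>

lemma orbit_coord_or_form_le:
  "x \<in> orbit \<Longrightarrow> x = coord i \<or> descartes_form (coord i) x \<le> -1"
proof (induction rule: orbit.induct)
  case (coord j)
  then show ?case by (auto simp: descartes_form_coord_coord)
next
  case (reflect x k)
  show ?case
  proof (cases "i = k")
    case True
    then show ?thesis using orbit_sum_ge[OF reflect.hyps(1)] reflect.hyps(2)
      by (simp add: descartes_form_coord sum_reflect) (simp add: reflect_def)
  next
    case False
    then have "x \<noteq> coord i" using reflect.hyps(2) by auto
    moreover have "descartes_form (coord i) (reflect k x) = descartes_form (coord i) x"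
      using False by (simp add: descartes_form_reflect[symmetric] reflect_coord)
    ultimately show ?thesis using reflect.IH by simp
  qed
qed

text \<open>A zero coordinate gives no change, a positive one the defining rule. A negative one is
  unique by \<open>orbit_signs\<close>, so it was produced by the last reflection, which is
  undone.\<close>

lemma orbit_reflect_closed:
  assumes "x \<in> orbit"
  shows "reflect k x \<in> orbit"
proof (cases "x k" "0 :: real" rule: linorder_cases)
  case less
  from assms show ?thesis
  proof cases
    case (coord i)
    then show ?thesis using less by (auto simp: coord_def split: if_splits)
  next
    case (reflect y j)
    have "x j < 0" using reflect by (simp add: reflect_def)
    then have "k = j"
      using orbit_signs[OF assms] less
      by (metis coord_simps linorder_not_less neg_0_le_iff_le order_less_imp_le order_trans zero_le_one
          less_le_not_le neg_less_0_iff_less)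
    then show ?thesis using reflect by simp
  qed
next
  case equal
  then show ?thesis using assms by (simp add: reflect_eq_self)
next
  case greater
  then show ?thesis using assms by (rule orbit.reflect[rotated])
qed

text \<open>A vector tangent to \<open>coord i\<close> has a nonnegative \<open>i\<close>-th coordinate, so the last reflection
  in its orbit word fixes \<open>coord i\<close>.\<close>

lemma orbit_tangent_reflect_index:
  assumes "x \<in> orbit" "0 < x k" "descartes_form (coord i) (reflect k x) = -1"
  shows "k \<noteq> i"
proof
  assume "k = i"
  then have "2 * reflect k x k - (\<Sum>j\<in>UNIV. reflect k x j) = -1"
    using assms(3) by (simp add: descartes_form_coord)
  moreover have "1 \<le> (\<Sum>j\<in>UNIV. reflect k x j)"
    using assms by (intro orbit_sum_ge orbit.reflect)
  ultimately show False using assms(2) by (simp add: reflect_def)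
qed

section \<open>Disks tangent to three mutually tangent disks of the orbit\<close>

lemma obtain_fourth_index:
  fixes i j l :: 4
  assumes "i \<noteq> j" "i \<noteq> l" "j \<noteq> l"
  obtains m where "m \<noteq> i" "m \<noteq> j" "m \<noteq> l" "UNIV = {i, j, l, m}"
proof -
  have "card {i, j, l} \<noteq> card (UNIV :: 4 set)" using assms by simp
  then have "{i, j, l} \<noteq> UNIV" by metis
  then obtain m where m: "m \<notin> {i, j, l}" by blast
  then have "card {i, j, l, m} = 4" using assms by auto
  then have "{i, j, l, m} = UNIV" by (intro card_eq_UNIV_imp_eq_UNIV) auto
  then show thesis using m by (intro that) auto
qed

text \<open>The tangency conditions express \<open>u\<close> through its coordinate sum
  \<open>s\<close>, and the norm leaves a quadratic in \<open>s\<close>. Its roots 1 and 5 are the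
  two Descartes solutions, \<open>coord m\<close> and its reflection.\<close>

lemma tangent_three_coords:
  assumes "i \<noteq> j" "i \<noteq> l" "j \<noteq> l" "descartes_form u u = 1"
    "descartes_form (coord i) u = -1" "descartes_form (coord j) u = -1"
    "descartes_form (coord l) u = -1"
  shows "u \<in> orbit"
proof -
  obtain m where m: "m \<noteq> i" "m \<noteq> j" "m \<noteq> l" "UNIV = {i, j, l, m}"
    using obtain_fourth_index assms(1-3) by metis
  define s where "s = (\<Sum>k\<in>UNIV. u k)"
  have u: "u i = (s - 1) / 2" "u j = (s - 1) / 2" "u l = (s - 1) / 2"
    using assms(5-7) by (simp_all add: descartes_form_coord s_def)
  have "s = u i + u j + u l + u m"
    unfolding s_def m(4) using m(1-3) assms(1-3) by simp
  then have um: "u m = (3 - s) / 2" using u by (simp add: field_simps)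
  have "(\<Sum>k\<in>UNIV. u k * u k) = u i * u i + u j * u j + u l * u l + u m * u m"
    unfolding m(4) using m(1-3) assms(1-3) by simp
  then have "1 = 2 * (u i * u i + u j * u j + u l * u l + u m * u m) - s * s"
    using assms(4) by (simp add: descartes_form_def s_def)
  then have "(s - 1) * (s - 5) = 0"
    unfolding u um by (simp add: field_simps)
  then consider "s = 1" | "s = 5" by auto
  then show ?thesis
  proof cases
    case 1
    have "u k = coord m k" for k
      using 1 u um m by (cases "k = m") (auto simp: coord_def)
    then have "u = coord m" by auto
    then show ?thesis by (simp add: orbit.coord)
  next
    case 2
    have "u k = reflect m (coord m) k" for k
      using 2 u um m by (cases "k = m") (auto simp: reflect_def)
    then have "u = reflect m (coord m)" by auto
    then show ?thesis by (simp add: orbit.coord orbit_reflect_closed)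
  qed
qed

text \<open>Descent on the third disk: its last reflection has an index other than \<open>i\<close>
  and \<open>j\<close>, so it fixes both unit vectors and can be undone on \<open>x\<close> and
  \<open>u\<close> together.\<close>

lemma tangent_two_coords:
  assumes "x \<in> orbit" "i \<noteq> j" "descartes_form u u = 1"
    "descartes_form (coord i) u = -1" "descartes_form (coord j) u = -1" "descartes_form x u = -1"
    "descartes_form (coord i) x = -1" "descartes_form (coord j) x = -1"
  shows "u \<in> orbit"
  using assms
proof (induction arbitrary: u rule: orbit.induct)
  case (coord l)
  then show ?case
    using tangent_three_coords[of i j l u] by (auto simp: descartes_form_coord_coord split: if_splits)
next
  case (reflect x k)
  have k: "k \<noteq> i" "k \<noteq> j"
    using orbit_tangent_reflect_index[OF reflect.hyps] reflect.prems by auto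
  have "reflect k u \<in> orbit"
    by (rule reflect.IH)
      (use reflect.prems k in \<open>simp_all add: descartes_form_reflect_reflect reflect_coord
        descartes_form_reflect[of k "coord _", symmetric] descartes_form_reflect[of k x u]\<close>)
  then show ?case using orbit_reflect_closed[of "reflect k u" k] by simp
qed

text \<open>The same descent beside one fixed unit vector, moving \<open>y\<close> and
  \<open>u\<close> along with \<open>x\<close>; once \<open>x\<close> is a unit vector, two are
  available.\<close>

lemma tangent_one_coord:
  assumes "x \<in> orbit" "y \<in> orbit" "descartes_form u u = 1"
    "descartes_form (coord i) u = -1" "descartes_form x u = -1" "descartes_form y u = -1"
    "descartes_form (coord i) x = -1" "descartes_form (coord i) y = -1" "descartes_form x y = -1"
  shows "u \<in> orbit"
  using assms
proof (induction arbitrary: u y rule: orbit.induct)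
  case (coord l)
  then show ?case
    using tangent_two_coords[of y i l u] by (auto simp: descartes_form_coord_coord split: if_splits)
next
  case (reflect x k)
  have k: "k \<noteq> i"
    using orbit_tangent_reflect_index[OF reflect.hyps] reflect.prems by auto
  have "reflect k u \<in> orbit"
    by (rule reflect.IH[of "reflect k y"])
      (use reflect.prems k in \<open>simp_all add: descartes_form_reflect_reflect reflect_coord orbit_reflect_closed
        descartes_form_reflect[of k "coord _", symmetric] descartes_form_reflect[of k x]\<close>)
  then show ?case using orbit_reflect_closed[of "reflect k u" k] by simp
qed

text \<open>The outermost descent: \<open>x\<close> is brought to a unit vector while
  \<open>y\<close>, \<open>z\<close> and \<open>u\<close> are carried along.\<close>

lemma tangent_to_orbit_triple:
  assumes "x \<in> orbit" "y \<in> orbit" "z \<in> orbit" "descartes_form u u = 1"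
    "descartes_form x u = -1" "descartes_form y u = -1" "descartes_form z u = -1"
    "descartes_form x y = -1" "descartes_form x z = -1" "descartes_form y z = -1"
  shows "u \<in> orbit"
  using assms
proof (induction arbitrary: u y z rule: orbit.induct)
  case (coord i)
  then show ?case by (rule tangent_one_coord)
next
  case (reflect x k)
  have "reflect k u \<in> orbit"
    by (rule reflect.IH[of "reflect k y" "reflect k z"])
      (use reflect.prems in \<open>simp_all add: descartes_form_reflect_reflect orbit_reflect_closed
        descartes_form_reflect[of k x]\<close>)
  then show ?case using orbit_reflect_closed[of "reflect k u" k] by simp
qed

section \<open>Disks as vectors\<close>

text \<open>The vector \<open>x\<close> stands for \<open>\<Sum>x\<^sub>iv\<^sub>i\<close>, where \<open>v\<^sub>i\<close> lists curvature, cocurvature (the curvature of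
  the image under inversion in the unit circle) and curvature times center: \<open>v\<^sub>1 = (-1, 1, 0)\<close>,
  \<open>v\<^sub>2 = (2, 0, 1)\<close>, \<open>v\<^sub>3 = (2, 0, -1)\<close>, \<open>v\<^sub>4 = (3, 1, 2i)\<close>.\<close>

definition curvature :: "(4 \<Rightarrow> real) \<Rightarrow> real" where
  "curvature x = - x 1 + 2 * x 2 + 2 * x 3 + 3 * x 4"

definition cocurvature :: "(4 \<Rightarrow> real) \<Rightarrow> real" where
  "cocurvature x = x 1 + x 4"

definition scaled_center :: "(4 \<Rightarrow> real) \<Rightarrow> complex" where
  "scaled_center x = Complex (x 2 - x 3) (2 * x 4)"

text \<open>One inequality for all three shapes: for a vector of norm 1, positive curvature gives a
  round disk, negative curvature an exterior and curvature 0 a half-plane.\<close>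

definition disk :: "(4 \<Rightarrow> real) \<Rightarrow> complex set" where
  "disk x = {z. curvature x * (norm z)\<^sup>2 - 2 * (scaled_center x \<bullet> z) + cocurvature x \<le> 0}"

definition center :: "(4 \<Rightarrow> real) \<Rightarrow> complex" where
  "center x = scaled_center x /\<^sub>R curvature x"

text \<open>Mutual tangency of the initial quadruple gives it a Gram matrix with 1 on the diagonal
  and -1 elsewhere, which is the matrix of \<open>descartes_form\<close>.\<close>

lemma descartes_form_lorentz:
  "descartes_form x y = scaled_center x \<bullet> scaled_center y
     - (curvature x * cocurvature y + curvature y * cocurvature x) / 2"
  by (simp add: descartes_form_def sum_4 scaled_center_def curvature_def cocurvature_def
      inner_complex_def field_simps)

lemma scaled_center_eq: "curvature x \<noteq> 0 \<Longrightarrow> scaled_center x = curvature x *\<^sub>R center x"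
  by (simp add: center_def)

lemma cocurvature_eq:
  assumes "descartes_form x x = 1" "curvature x \<noteq> 0"
  shows "cocurvature x = curvature x * ((norm (center x))\<^sup>2 - (1 / curvature x)\<^sup>2)"
proof -
  have "curvature x * cocurvature x = (curvature x)\<^sup>2 * (norm (center x))\<^sup>2 - 1"
    using assms by (simp add: descartes_form_lorentz scaled_center_eq dot_square_norm power_mult_distrib algebra_simps)
  then have "curvature x * cocurvature x =
      curvature x * (curvature x * ((norm (center x))\<^sup>2 - (1 / curvature x)\<^sup>2))"
    using assms(2) by (simp add: right_diff_distrib power_divide) (simp add: power2_eq_square)
  then show ?thesis using assms(2) by simp
qed

lemma dist_power2_eq:
  fixes c z :: complex
  shows "(dist c z)\<^sup>2 = (norm c)\<^sup>2 - 2 * (c \<bullet> z) + (norm z)\<^sup>2"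
  by (simp add: dist_norm power2_norm_eq_inner inner_diff_left inner_diff_right inner_commute)

lemma disk_quadratic_eq:
  assumes "descartes_form x x = 1" "curvature x \<noteq> 0"
  shows "curvature x * (norm z)\<^sup>2 - 2 * (scaled_center x \<bullet> z) + cocurvature x
    = curvature x * ((dist (center x) z)\<^sup>2 - (1 / curvature x)\<^sup>2)"
  by (simp add: cocurvature_eq[OF assms] scaled_center_eq[OF assms(2)] dist_power2_eq algebra_simps)

text \<open>The inversive product (r^2 + s^2 - d^2) / (2 r s) of circles with signed radii r, s and
  center distance d.\<close>

lemma descartes_form_dist:
  assumes "descartes_form x x = 1" "curvature x \<noteq> 0" "descartes_form y y = 1" "curvature y \<noteq> 0"
  shows "descartes_form x y = curvature x * curvature y / 2 *
    ((1 / curvature x)\<^sup>2 + (1 / curvature y)\<^sup>2 - (dist (center x) (center y))\<^sup>2)"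
  by (simp add: descartes_form_lorentz[of x y] cocurvature_eq assms scaled_center_eq dist_power2_eq
      algebra_simps add_divide_distrib diff_divide_distrib)

lemma disk_eq_cball:
  assumes "descartes_form x x = 1" "curvature x > 0"
  shows "disk x = cball (center x) (1 / curvature x)"
proof -
  have "(dist (center x) z)\<^sup>2 \<le> (1 / curvature x)\<^sup>2 \<longleftrightarrow> dist (center x) z \<le> 1 / curvature x" for z
    using assms(2) abs_le_square_iff[of "dist (center x) z" "1 / curvature x"] by simp
  then show ?thesis using assms
    unfolding disk_def by (subst disk_quadratic_eq) (auto simp: mult_le_0_iff)
qed

lemma disk_eq_compl_ball:
  assumes "descartes_form x x = 1" "curvature x < 0"
  shows "disk x = - ball (center x) (- 1 / curvature x)"
proof -
  have "(- 1 / curvature x)\<^sup>2 \<le> (dist (center x) z)\<^sup>2 \<longleftrightarrow> - 1 / curvature x \<le> dist (center x) z" for z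
    using assms(2) abs_le_square_iff[of "- 1 / curvature x" "dist (center x) z"]
    by (simp add: divide_nonpos_neg)
  then have "z \<in> disk x \<longleftrightarrow> z \<in> - ball (center x) (- 1 / curvature x)" for z
    using assms unfolding disk_def mem_Collect_eq
    by (subst disk_quadratic_eq) (simp_all add: mult_le_0_iff not_less)
  then show ?thesis by blast
qed

lemma ex_coordinates: "\<exists>x. curvature x = b \<and> cocurvature x = b' \<and> scaled_center x = w"
proof -
  \<comment> \<open>The linear system is triangular: the imaginary part of \<open>w\<close> gives
    \<open>x 4\<close>, then \<open>b'\<close> gives \<open>x 1\<close>; \<open>b\<close> and the
    real part of \<open>w\<close> give the sum and the difference of \<open>x 2\<close> and
    \<open>x 3\<close>.\<close>
  define d where "d = Im w / 2"
  define x :: "4 \<Rightarrow> real" where "x = (\<lambda>i. if i = 1 then b' - d else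
    if i = 2 then ((b + b' - 4 * d) / 2 + Re w) / 2 else
    if i = 3 then ((b + b' - 4 * d) / 2 - Re w) / 2 else d)"
  have "curvature x = b \<and> cocurvature x = b' \<and> scaled_center x = w"
    by (simp add: x_def d_def curvature_def cocurvature_def scaled_center_def complex_eq_iff field_simps)
  then show ?thesis by blast
qed

lemma is_disk_imp_disk:
  assumes "is_disk D"
  shows "\<exists>x. descartes_form x x = 1 \<and> D = disk x"
proof -
  have round: "\<exists>x. descartes_form x x = 1 \<and> curvature x = b \<and> center x = c"
    if "b \<noteq> 0" for b :: real and c
  proof -
    obtain x where x: "curvature x = b" "cocurvature x = b * ((norm c)\<^sup>2 - (1 / b)\<^sup>2)"
      "scaled_center x = b *\<^sub>R c" using ex_coordinates by metis
    have "descartes_form x x = 1"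
      using that by (simp add: descartes_form_lorentz x dot_square_norm field_simps power2_eq_square)
    moreover have "center x = c" using that by (simp add: center_def x)
    ultimately show ?thesis using x by blast
  qed
  consider c r where "0 < r" "D = cball c r" | c r where "0 < r" "D = - ball c r"
    | u t where "u \<noteq> 0" "D = {z. u \<bullet> z \<le> t}"
    using assms unfolding is_disk_def by blast
  then show ?thesis
  proof cases
    case 1
    with round[of "1 / r" c] show ?thesis by (metis disk_eq_cball div_by_1 divide_divide_eq_right
          less_numeral_extra(3) mult_1 zero_less_divide_1_iff)
  next
    case 2
    then obtain x where x: "descartes_form x x = 1" "curvature x = - (1 / r)" "center x = c"
      using round[of "- (1 / r)" c] by auto
    then have "disk x = - ball c r" using 2 disk_eq_compl_ball[of x] by simp
    then show ?thesis using x 2 by auto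
  next
    case 3
    \<comment> \<open>At curvature 0, norm 1 means that the scaled center is a unit vector, so the
      inequality is divided by \<open>norm u\<close>.\<close>
    obtain x where x: "curvature x = 0" "cocurvature x = - 2 * t / norm u"
      "scaled_center x = - (u /\<^sub>R norm u)" using ex_coordinates by metis
    have "descartes_form x x = 1"
      using 3 by (simp add: descartes_form_lorentz x dot_square_norm)
    moreover have "disk x = D"
      using 3 by (auto simp: disk_def x field_simps)
    ultimately show ?thesis by blast
  qed
qed

section \<open>Tangency implies product -1\<close>

lemma tangent_disks_frontier:
  assumes "tangent_disks D E" "bounded (frontier E)"
  obtains p where "p \<in> frontier D" "p \<in> frontier E"
proof -
  obtain q where "q \<in> boundary_circle D \<inter> boundary_circle E"
    using assms(1) unfolding tangent_disks_def by blast
  then show thesis using assms(2) that by (auto simp: boundary_circle_def split: if_splits)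
qed

lemma frontier_disk:
  assumes "descartes_form x x = 1" "curvature x \<noteq> 0"
  shows "frontier (disk x) = sphere (center x) \<bar>1 / curvature x\<bar>"
proof (cases "curvature x > 0")
  case True
  then show ?thesis using assms by (simp add: disk_eq_cball)
next
  case False
  then have "curvature x < 0" using assms by simp
  then show ?thesis using assms
    by (simp add: disk_eq_compl_ball frontier_complement divide_nonpos_neg)
qed

lemma interior_disk_pos:
  "\<lbrakk>descartes_form x x = 1; curvature x > 0\<rbrakk> \<Longrightarrow> interior (disk x) = ball (center x) (1 / curvature x)"
  by (simp add: disk_eq_cball)

lemma interior_disk_neg:
  "\<lbrakk>descartes_form x x = 1; curvature x < 0\<rbrakk>
    \<Longrightarrow> interior (disk x) = - cball (center x) (- 1 / curvature x)"
  by (simp add: disk_eq_compl_ball interior_complement divide_neg_neg)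

lemma descartes_form_eq_minus_one_iff:
  assumes "descartes_form x x = 1" "curvature x \<noteq> 0" "descartes_form y y = 1" "curvature y \<noteq> 0"
  shows "descartes_form x y = -1 \<longleftrightarrow>
    (dist (center x) (center y))\<^sup>2 = (1 / curvature x + 1 / curvature y)\<^sup>2"
proof -
  define r s where "r = 1 / curvature x" and "s = 1 / curvature y"
  have "descartes_form x y * (2 * r * s) = r\<^sup>2 + s\<^sup>2 - (dist (center x) (center y))\<^sup>2"
    unfolding descartes_form_dist[OF assms] r_def s_def using assms(2,4) by simp
  moreover have "2 * r * s \<noteq> 0" using assms(2,4) by (simp add: r_def s_def)
  then have "descartes_form x y = -1 \<longleftrightarrow> descartes_form x y * (2 * r * s) = -1 * (2 * r * s)"
    by (metis mult_right_cancel)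
  ultimately show ?thesis by (auto simp: r_def[symmetric] s_def[symmetric] power2_sum)
qed

lemma disjoint_balls_dist:
  fixes c c' :: complex
  assumes "ball c r \<inter> ball c' r' = {}" "0 < r" "0 < r'"
  shows "r + r' \<le> dist c c'"
proof (rule ccontr)
  assume "\<not> ?thesis"
  then have lt: "dist c c' < r + r'" by simp
  \<comment> \<open>The point dividing the segment of centers in the ratio of the radii lies in both
    balls if these overlap.\<close>
  define p where "p = c + (r / (r + r')) *\<^sub>R (c' - c)"
  have "c' - p = (r' / (r + r')) *\<^sub>R (c' - c)"
    using assms by (simp add: p_def complex_eq_iff field_simps)
  then have "dist p c' = r' / (r + r') * dist c c'"
    using assms by (metis dist_norm dist_commute norm_scaleR abs_of_pos add_pos_pos divide_pos_pos)
  moreover have "dist p c = r / (r + r') * dist c c'"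
    using assms by (simp add: p_def dist_norm norm_minus_commute)
  moreover have "r / (r + r') * dist c c' < r" "r' / (r + r') * dist c c' < r'"
    using assms lt by (simp_all add: pos_divide_less_eq)
  ultimately have "p \<in> ball c r \<inter> ball c' r'" by (simp add: dist_commute)
  then show False using assms by blast
qed

text \<open>A disk adjoined to the packing could a priori be a half-plane. The common boundary point
  bounds the signed distance from the center of \<open>disk y\<close> to the line by the radius from
  above, disjointness bounds it from below.\<close>

lemma tangent_half_plane_imp_form:
  assumes x: "descartes_form x x = 1" "curvature x = 0"
    and y: "descartes_form y y = 1" "curvature y \<noteq> 0"
    and t: "tangent_disks (disk x) (disk y)"
  shows "curvature y > 0 \<and> descartes_form x y = -1"
proof -
  define w where "w = scaled_center x"
  define t where "t = cocurvature x / 2"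
  have w1: "norm w = 1"
    using x by (simp add: descartes_form_lorentz w_def norm_eq_sqrt_inner)
  have "w \<noteq> 0" using w1 by auto
  have D: "disk x = {z. w \<bullet> z \<ge> t}"
    using x by (auto simp: disk_def w_def t_def)
  have I: "interior (disk x) = {z. w \<bullet> z > t}" and F: "frontier (disk x) = {z. w \<bullet> z = t}"
    unfolding D using \<open>w \<noteq> 0\<close> by (simp_all add: interior_halfspace_ge frontier_halfspace_ge)
  have dj: "interior (disk x) \<inter> interior (disk y) = {}"
    using t by (simp add: tangent_disks_def)
  have pos: "curvature y > 0"
  proof (rule ccontr)
    assume "\<not> ?thesis"
    then have "curvature y < 0" using y by simp
    then have sub: "{z. w \<bullet> z > t} \<subseteq> cball (center y) (- 1 / curvature y)"
      using dj I interior_disk_neg y by blast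
    \<comment> \<open>Far enough along the inner normal to lie in the half-plane and outside the
      bounded complement of \<open>disk y\<close>.\<close>
    define s where "s = \<bar>t\<bar> + 1 + norm (center y) + \<bar>- 1 / curvature y\<bar>"
    have "w \<bullet> (s *\<^sub>R w) = s" using w1 by (simp add: dot_square_norm)
    moreover have "s > t" unfolding s_def
      using norm_ge_zero[of "center y"] by linarith
    ultimately have "s *\<^sub>R w \<in> {z. w \<bullet> z > t}" by (metis mem_Collect_eq)
    then have "s *\<^sub>R w \<in> cball (center y) (- 1 / curvature y)" using sub by blast
    then have "dist (center y) (s *\<^sub>R w) \<le> - 1 / curvature y" by simp
    moreover have "norm (s *\<^sub>R w) = s" using w1 by (simp add: s_def)
    moreover have "norm (s *\<^sub>R w) - norm (center y) \<le> dist (center y) (s *\<^sub>R w)"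
      by (metis dist_norm norm_minus_commute norm_triangle_ineq2)
    ultimately show False unfolding s_def by linarith
  qed
  define r where "r = 1 / curvature y"
  have "r > 0" using pos by (simp add: r_def)
  obtain p where p: "p \<in> frontier (disk x)" "p \<in> frontier (disk y)"
    using tangent_disks_frontier[OF t] y by (auto simp: frontier_disk)
  have "dist (center y) p = r" using p(2) y pos by (simp add: frontier_disk r_def)
  have "w \<bullet> (p - center y) \<le> norm w * norm (p - center y)" by (rule norm_cauchy_schwarz)
  then have 1: "t - w \<bullet> center y \<le> r"
    using p(1) F w1 \<open>dist (center y) p = r\<close>
    by (simp add: inner_diff_right dist_norm norm_minus_commute)
  have 2: "r \<le> t - w \<bullet> center y"
  proof (rule ccontr)
    assume "\<not> ?thesis"
    \<comment> \<open>If the line came closer than \<open>r\<close>, a point at distance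
      \<open>s\<close> from the center along the normal would lie in both interiors; the maximum
      with 0 keeps \<open>s\<close> positive.\<close>
    then have "max (t - w \<bullet> center y) 0 < r" using \<open>r > 0\<close> by simp
    then obtain s where s: "max (t - w \<bullet> center y) 0 < s" "s < r" using dense by blast
    have "w \<bullet> (center y + s *\<^sub>R w) = w \<bullet> center y + s"
      using w1 by (simp add: inner_add_right dot_square_norm)
    then have "center y + s *\<^sub>R w \<in> interior (disk x)" using s I by simp
    moreover have "center y + s *\<^sub>R w \<in> interior (disk y)"
      using s w1 y pos by (simp add: interior_disk_pos dist_norm r_def)
    ultimately show False using dj by blast
  qed
  have "descartes_form x y = curvature y * (w \<bullet> center y - t)"
    using x y by (simp add: descartes_form_lorentz[of x y] scaled_center_eq w_def t_def algebra_simps)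
  also have "w \<bullet> center y - t = - r" using 1 2 by simp
  finally show ?thesis using pos by (simp add: r_def)
qed

text \<open>The common boundary point gives the triangle inequalities \<open>tri\<close> and
  disjoint interiors give the opposite bound, so the center distance is the absolute value of the
  sum of the signed radii.\<close>

lemma tangent_disks_imp_form:
  assumes x: "descartes_form x x = 1"
    and y: "descartes_form y y = 1" "curvature y \<noteq> 0"
    and t: "tangent_disks (disk x) (disk y)"
  shows "descartes_form x y = -1"
proof (cases "curvature x = 0")
  case True
  then show ?thesis using tangent_half_plane_imp_form assms by blast
next
  case False
  have dj: "interior (disk x) \<inter> interior (disk y) = {}"
    using t by (simp add: tangent_disks_def)
  obtain p where p: "dist (center x) p = \<bar>1 / curvature x\<bar>" "dist (center y) p = \<bar>1 / curvature y\<bar>"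
    using tangent_disks_frontier[OF t] x y False by (auto simp: frontier_disk)
  have tri: "dist (center x) (center y) \<le> dist (center x) p + dist (center y) p"
      "dist (center x) p \<le> dist (center x) (center y) + dist (center y) p"
      "dist (center y) p \<le> dist (center x) (center y) + dist (center x) p"
    by (metis dist_commute dist_triangle)+
  consider "curvature x > 0" "curvature y > 0" | "curvature x > 0" "curvature y < 0"
    | "curvature x < 0" "curvature y > 0" | "curvature x < 0" "curvature y < 0"
    using False y by linarith
  then have "dist (center x) (center y) = \<bar>1 / curvature x + 1 / curvature y\<bar>"
  proof cases
    case 1
    then have "1 / curvature x + 1 / curvature y \<le> dist (center x) (center y)"
      using dj x y by (intro disjoint_balls_dist) (simp_all add: interior_disk_pos)
    then show ?thesis using 1 p tri by simp
  next
    case 2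
    then have "ball (center x) (1 / curvature x) \<subseteq> cball (center y) (- 1 / curvature y)"
      using dj x y by (auto simp: interior_disk_pos interior_disk_neg)
    then have "dist (center x) (center y) + 1 / curvature x \<le> - 1 / curvature y"
      using 2 by (simp add: ball_subset_cball_iff not_le)
    moreover have "1 / curvature x > 0" "1 / curvature y < 0" using 2 by simp_all
    ultimately show ?thesis using p tri by (simp add: abs_if)
  next
    case 3
    then have "ball (center y) (1 / curvature y) \<subseteq> cball (center x) (- 1 / curvature x)"
      using dj x y by (auto simp: interior_disk_pos interior_disk_neg)
    then have "dist (center y) (center x) + 1 / curvature y \<le> - 1 / curvature x"
      using 3 by (simp add: ball_subset_cball_iff not_le)
    moreover have "1 / curvature y > 0" "1 / curvature x < 0" using 3 by simp_all
    moreover have "dist (center y) (center x) = dist (center x) (center y)"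
      by (rule dist_commute)
    ultimately show ?thesis using p tri by linarith
  next
    case 4
    \<comment> \<open>Two exteriors with disjoint interiors would cover the plane by their bounded
      complements and circles.\<close>
    have "UNIV = cball (center x) (- 1 / curvature x) \<union> cball (center y) (- 1 / curvature y)"
      using dj x y 4 by (auto simp: interior_disk_neg)
    then have "bounded (UNIV :: complex set)" by (metis bounded_Un bounded_cball)
    then show ?thesis by simp
  qed
  then show ?thesis using descartes_form_eq_minus_one_iff[OF x False y] by simp
qed

section \<open>Product -1 implies tangency in the orbit\<close>

lemma dist_convex_comb_power2:
  fixes c c' z :: complex
  shows "(dist ((1 - t) *\<^sub>R c + t *\<^sub>R c') z)\<^sup>2 =
    (1 - t) * (dist c z)\<^sup>2 + t * (dist c' z)\<^sup>2 - t * (1 - t) * (dist c c')\<^sup>2"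
  by (simp add: dist_norm power2_norm_eq_inner inner_complex_def algebra_simps)

text \<open>With signed radii, external and internal tangency are the same case.\<close>

lemma spheres_tangent_inter:
  fixes c c' :: complex
  assumes d: "(dist c c')\<^sup>2 = (r + r')\<^sup>2" and "r + r' \<noteq> 0"
  shows "\<exists>p. sphere c \<bar>r\<bar> \<inter> sphere c' \<bar>r'\<bar> = {p}"
proof -
  \<comment> \<open>The tangency point divides the line of centers in the signed ratio
    \<open>r\<close> to \<open>r'\<close>, outside the segment for internal tangency.\<close>
  define t where "t = r / (r + r')"
  define p where "p = (1 - t) *\<^sub>R c + t *\<^sub>R c'"
  have t': "1 - t = r' / (r + r')" using assms(2) by (simp add: t_def field_simps)
  have "z = p" if "dist c z = \<bar>r\<bar>" "dist c' z = \<bar>r'\<bar>" for z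
  proof -
    \<comment> \<open>Stewart's theorem, applied to a common point \<open>z\<close> of the two
      circles.\<close>
    have "(dist p z)\<^sup>2 = (1 - t) * r\<^sup>2 + t * r'\<^sup>2 - t * (1 - t) * (r + r')\<^sup>2"
      unfolding p_def dist_convex_comb_power2 d that by simp
    also have "\<dots> = 0"
      unfolding t' unfolding t_def using assms(2) by (simp add: divide_simps) algebra
    finally show ?thesis by simp
  qed
  moreover have "dist c p = \<bar>r\<bar>"
  proof -
    have "(dist c p)\<^sup>2 = t\<^sup>2 * (dist c c')\<^sup>2"
      unfolding p_def by (subst dist_commute, subst dist_convex_comb_power2)
        (simp add: dist_commute algebra_simps power2_eq_square)
    also have "\<dots> = r\<^sup>2" unfolding d t_def using assms(2) by (simp add: field_simps)
    finally show ?thesis by (metis abs_of_nonneg real_sqrt_abs zero_le_dist)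
  qed
  moreover have "dist c' p = \<bar>r'\<bar>"
  proof -
    have "(dist c' p)\<^sup>2 = (1 - t)\<^sup>2 * (dist c c')\<^sup>2"
      unfolding p_def by (subst dist_commute, subst dist_convex_comb_power2)
        (simp add: dist_commute algebra_simps power2_eq_square)
    also have "\<dots> = r'\<^sup>2" unfolding d t' using assms(2) by (simp add: field_simps)
    finally show ?thesis by (metis abs_of_nonneg real_sqrt_abs zero_le_dist)
  qed
  ultimately have "z \<in> sphere c \<bar>r\<bar> \<inter> sphere c' \<bar>r'\<bar> \<longleftrightarrow> z = p" for z
    unfolding Int_iff mem_sphere by blast
  then have "sphere c \<bar>r\<bar> \<inter> sphere c' \<bar>r'\<bar> = {p}" by blast
  then show ?thesis ..
qed

text \<open>The product with \<open>coord 1\<close> bounds \<open>x 2 + x 3 + x 4\<close> below by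
  \<open>x 1 + 1\<close>, so the curvature is at least \<open>x 1 + x 4 + 2\<close>; the sign
  pattern makes \<open>x 1 + x 4\<close> nonnegative. In particular no half-plane occurs.\<close>

lemma orbit_curvature_ge:
  assumes "x \<in> orbit"
  shows "x = coord 1 \<or> 2 \<le> curvature x"
proof (rule disjCI)
  assume "\<not> 2 \<le> curvature x"
  show "x = coord 1"
  proof (rule ccontr)
    assume "x \<noteq> coord 1"
    then have "descartes_form (coord 1) x \<le> -1" using orbit_coord_or_form_le[OF assms] by blast
    then have "x 2 + x 3 + x 4 \<ge> x 1 + 1" by (simp add: descartes_form_coord sum_4)
    moreover have "x 1 + x 4 \<ge> 0"
      using orbit_signs[OF assms]
    proof
      assume "\<exists>i. x = coord i"
      then show ?thesis by (auto simp: coord_def)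
    next
      assume "\<exists>j. x j < 0 \<and> (\<forall>k. k \<noteq> j \<longrightarrow> - x j \<le> x k)"
      then obtain j where j: "x j < 0" "\<And>k. k \<noteq> j \<Longrightarrow> - x j \<le> x k" by blast
      show ?thesis using j(1) j(2)[of 1] j(2)[of 4] by (cases "j = 1"; cases "j = 4") auto
    qed
    ultimately show False using \<open>\<not> 2 \<le> curvature x\<close> by (simp add: curvature_def)
  qed
qed

lemma curvature_coord_1: "curvature (coord 1) = -1"
  by (simp add: curvature_def)

lemma center_coord_1: "center (coord 1) = 0"
  by (simp add: center_def scaled_center_def complex_eq_iff)

lemma orbit_form_imp_tangent:
  assumes "x \<in> orbit" "y \<in> orbit" and f: "descartes_form x y = -1"
  shows "tangent_disks (disk x) (disk y)"
proof -
  have n: "descartes_form x x = 1" "descartes_form y y = 1"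
    using assms by (simp_all add: orbit_norm)
  have cx: "x = coord 1 \<or> 2 \<le> curvature x" and cy: "y = coord 1 \<or> 2 \<le> curvature y"
    using assms orbit_curvature_ge by blast+
  have nz: "curvature x \<noteq> 0" "curvature y \<noteq> 0"
    using cx cy by (auto simp: curvature_coord_1)
  have not1: "\<not> (x = coord 1 \<and> y = coord 1)"
    using f by (auto simp: descartes_form_coord_coord)
  have d2: "(dist (center x) (center y))\<^sup>2 = (1 / curvature x + 1 / curvature y)\<^sup>2"
    using f n nz descartes_form_eq_minus_one_iff by blast
  \<comment> \<open>The curvatures are -1 or at least 2, and not both are -1, so the two circles
    cannot coincide.\<close>
  have "curvature x + curvature y \<noteq> 0"
    using cx cy not1 by (auto simp: curvature_coord_1)
  then have "1 / curvature x + 1 / curvature y \<noteq> 0"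
    using nz by (simp add: field_simps)
  then obtain p where p: "frontier (disk x) \<inter> frontier (disk y) = {p}"
    using spheres_tangent_inter[OF d2] n nz by (auto simp: frontier_disk)
  have "bounded (frontier (disk x))" "bounded (frontier (disk y))"
    using n nz by (simp_all add: frontier_disk)
  then have "boundary_circle (disk x) \<inter> boundary_circle (disk y) = {Some p}"
    using p by (auto simp: boundary_circle_def)
  moreover have "interior (disk x) \<inter> interior (disk y) = {}"
  proof -
    have d: "dist (center x) (center y) = \<bar>1 / curvature x + 1 / curvature y\<bar>"
      using d2 by (metis abs_of_nonneg real_sqrt_abs zero_le_dist)
    \<comment> \<open>Since the radius is at most 1, the center lies at distance 1 minus the radius
      from 0, which places the disk inside the unit circle.\<close>
    have ext: "interior (disk (coord 1)) \<inter> interior (disk z) = {}"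
      if "descartes_form z z = 1" "2 \<le> curvature z" "norm (center z) = \<bar>-1 + 1 / curvature z\<bar>" for z
    proof -
      have "1 / curvature z \<le> 1" using that by simp
      then have "norm (center z) + 1 / curvature z \<le> 1" using that by simp
      then have "ball (center z) (1 / curvature z) \<subseteq> cball 0 1"
        by (simp add: ball_subset_cball_iff)
      then show ?thesis using that
        by (auto simp: interior_disk_pos interior_disk_neg curvature_coord_1 center_coord_1
            descartes_form_coord_coord)
    qed
    consider "x = coord 1" "2 \<le> curvature y" | "y = coord 1" "2 \<le> curvature x"
      | "2 \<le> curvature x" "2 \<le> curvature y" using cx cy not1 by blast
    then show ?thesis
    proof cases
      case 1
      then show ?thesis using ext[of y] n d by (simp add: curvature_coord_1 center_coord_1)
    next
      case 2
      then show ?thesis using ext[of x] n d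
        by (simp add: curvature_coord_1 center_coord_1 Int_commute)
    next
      case 3
      then show ?thesis using n d by (simp add: interior_disk_pos disjoint_ballI)
    qed
  qed
  ultimately show ?thesis unfolding tangent_disks_def by blast
qed

section \<open>The packing is the orbit\<close>

lemma curvature_orbit_nonzero: "x \<in> orbit \<Longrightarrow> curvature x \<noteq> 0"
  using orbit_curvature_ge[of x] by (auto simp: curvature_coord_1)

lemma disk_coord:
  "disk (coord 1) = great_disk"
  "disk (coord 2) = cball (Complex (1/2) 0) (1/2)"
  "disk (coord 3) = cball (Complex (-1/2) 0) (1/2)"
proof -
  have n: "descartes_form (coord i) (coord i) = 1" for i by (simp add: descartes_form_coord_coord)
  have "curvature (coord 2) = 2" "curvature (coord 3) = 2" by (simp_all add: curvature_def)
  moreover have "center (coord 2) = Complex (1/2) 0" "center (coord 3) = Complex (-1/2) 0"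
    by (simp_all add: center_def curvature_def scaled_center_def complex_eq_iff)
  ultimately show "disk (coord 2) = cball (Complex (1/2) 0) (1/2)"
    "disk (coord 3) = cball (Complex (-1/2) 0) (1/2)"
    using disk_eq_cball[OF n] by simp_all
  show "disk (coord 1) = great_disk"
    using disk_eq_compl_ball[OF n] by (simp add: great_disk_def curvature_coord_1 center_coord_1)
qed

lemma apollonian_window_altdef:
  "apollonian_window = apollonian_packing {disk (coord 1), disk (coord 2), disk (coord 3)}"
  by (simp add: apollonian_window_def disk_coord)

lemma orbit_tangent_imp_form:
  "\<lbrakk>x \<in> orbit; y \<in> orbit; tangent_disks (disk x) (disk y)\<rbrakk> \<Longrightarrow> descartes_form x y = -1"
  by (intro tangent_disks_imp_form) (simp_all add: orbit_norm curvature_orbit_nonzero)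

text \<open>An adjoined disk has some vector \<open>u\<close> of norm 1; its three tangencies become
  products -1, and \<open>tangent_to_orbit_triple\<close> puts \<open>u\<close> into the
  orbit.\<close>

lemma window_subset_orbit:
  assumes "D \<in> apollonian_window"
  shows "\<exists>x \<in> orbit. D = disk x"
  using assms unfolding apollonian_window_altdef
proof (induction rule: apollonian_packing.induct)
  case (initial D)
  then show ?case using orbit.coord by blast
next
  case (adjoin D1 D2 D3 D)
  then obtain x y z where x: "x \<in> orbit" "D1 = disk x" and y: "y \<in> orbit" "D2 = disk y"
    and z: "z \<in> orbit" "D3 = disk z" by blast
  obtain u where u: "descartes_form u u = 1" "D = disk u"
    using is_disk_imp_disk adjoin.hyps by blast
  have "descartes_form u v = -1" if "v \<in> orbit" "tangent_disks D (disk v)" for v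
    using that u by (intro tangent_disks_imp_form) (simp_all add: orbit_norm curvature_orbit_nonzero)
  then have "descartes_form x u = -1" "descartes_form y u = -1" "descartes_form z u = -1"
    using adjoin.hyps x y z by (metis descartes_form_commute)+
  moreover have "descartes_form x y = -1" "descartes_form x z = -1" "descartes_form y z = -1"
    using adjoin.hyps x y z orbit_tangent_imp_form by metis+
  ultimately have "u \<in> orbit" using tangent_to_orbit_triple[of x y z u] x y z u by blast
  then show ?case using u by blast
qed

lemma is_disk_orbit:
  assumes "x \<in> orbit"
  shows "is_disk (disk x)"
proof (cases "curvature x > 0")
  case True
  then show ?thesis unfolding is_disk_def
    using disk_eq_cball[OF orbit_norm[OF assms]] zero_less_divide_1_iff by blast
next
  case False
  then have "curvature x < 0" using curvature_orbit_nonzero[OF assms] by simp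
  then show ?thesis unfolding is_disk_def
    using disk_eq_compl_ball[OF orbit_norm[OF assms]] divide_neg_neg[of "-1" "curvature x"]
    by (metis neg_less_0_iff_less zero_less_one)
qed

lemma window_adjoin:
  assumes "x \<in> orbit" "y \<in> orbit" "z \<in> orbit" "u \<in> orbit"
    and "disk x \<in> apollonian_window" "disk y \<in> apollonian_window" "disk z \<in> apollonian_window"
    and "descartes_form x y = -1" "descartes_form x z = -1" "descartes_form y z = -1"
    and "descartes_form u x = -1" "descartes_form u y = -1" "descartes_form u z = -1"
  shows "disk u \<in> apollonian_window"
  unfolding apollonian_window_def
  by (rule apollonian_packing.adjoin[of "disk x" _ "disk y" "disk z"])
    (use assms in \<open>simp_all add: is_disk_orbit orbit_form_imp_tangent apollonian_window_def\<close>)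

lemma foldr_reflect_orbit: "x \<in> orbit \<Longrightarrow> foldr reflect w x \<in> orbit"
  by (induction w) (simp_all add: orbit_reflect_closed)

lemma descartes_form_foldr_reflect:
  "descartes_form (foldr reflect w x) (foldr reflect w y) = descartes_form x y"
  by (induction w) (simp_all add: descartes_form_reflect_reflect)

text \<open>Words can be taken apart at the inner end, next to \<open>coord i\<close>, whereas rule
  induction on the orbit peels off the outermost reflection.\<close>

lemma orbit_word: "x \<in> orbit \<Longrightarrow> \<exists>w i. x = foldr reflect w (coord i)"
proof (induction rule: orbit.induct)
  case (coord i)
  show ?case by (rule exI[of _ "[]"]) auto
next
  case (reflect x k)
  then obtain w i where "x = foldr reflect w (coord i)" by blast
  then have "reflect k x = foldr reflect (k # w) (coord i)" by simp
  then show ?case by blast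
qed

lemma other_indices:
  fixes k :: 4
  obtains i j l where "i \<noteq> j" "i \<noteq> l" "j \<noteq> l" "k \<noteq> i" "k \<noteq> j" "k \<noteq> l"
proof -
  consider "k = 1" | "k = 2" | "k = 3" | "k = 4" using exhaust_4[of k] by blast
  then show thesis
  proof cases
    case 1 show thesis by (rule that[of 2 3 4]) (simp_all add: 1)
  next
    case 2 show thesis by (rule that[of 1 3 4]) (simp_all add: 2)
  next
    case 3 show thesis by (rule that[of 1 2 4]) (simp_all add: 3)
  next
    case 4 show thesis by (rule that[of 1 2 3]) (simp_all add: 4)
  qed
qed

text \<open>The whole Descartes quadruple is carried along: appending a letter to the word replaces
  one of its members by the other disk tangent to the remaining three.\<close>

lemma window_word: "disk (foldr reflect w (coord i)) \<in> apollonian_window"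
proof (induction w arbitrary: i rule: rev_induct)
  case Nil
  have init: "disk (coord i) \<in> apollonian_window" if "i \<in> {1, 2, 3}" for i
    using that unfolding apollonian_window_altdef by (auto intro: apollonian_packing.initial)
  \<comment> \<open>The fourth disk of the quadruple is adjoined to the three initial ones.\<close>
  have "disk (coord 4) \<in> apollonian_window"
    by (rule window_adjoin[of "coord 1" "coord 2" "coord 3"])
      (simp_all add: init orbit.coord descartes_form_coord_coord)
  then show ?case using init[of i] exhaust_4[of i] by auto
next
  case (snoc k w)
  show ?case
  proof (cases "i = k")
    case False
    then show ?thesis using snoc by (simp add: reflect_coord)
  next
    case True
    let ?v = "\<lambda>x. foldr reflect w x"
    obtain a b c where abc: "a \<noteq> b" "a \<noteq> c" "b \<noteq> c" "k \<noteq> a" "k \<noteq> b" "k \<noteq> c"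
      using other_indices .
    have "disk (?v (reflect k (coord k))) \<in> apollonian_window"
      by (rule window_adjoin[of "?v (coord a)" "?v (coord b)" "?v (coord c)"])
        (use abc in \<open>simp_all add: snoc descartes_form_foldr_reflect descartes_form_coord_coord
          foldr_reflect_orbit orbit.coord orbit_reflect_closed descartes_form_reflect reflect_coord\<close>)
    then show ?thesis using True by simp
  qed
qed

lemma window_eq_orbit: "apollonian_window = disk ` orbit"
proof (intro equalityI subsetI)
  show "D \<in> disk ` orbit" if "D \<in> apollonian_window" for D
    using window_subset_orbit[OF that] by auto
  show "D \<in> apollonian_window" if "D \<in> disk ` orbit" for D
    using that orbit_word window_word by force
qed

lemma corona_eq_orbit:
  "corona apollonian_window great_disk = disk ` {x \<in> orbit. descartes_form (coord 1) x = -1}"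
proof -
  have "tangent_disks (disk (coord 1)) (disk x) \<longleftrightarrow> descartes_form (coord 1) x = -1" if "x \<in> orbit" for x
    using that orbit_tangent_imp_form[OF orbit.coord] orbit_form_imp_tangent[OF orbit.coord] by blast
  then show ?thesis
    unfolding corona_def window_eq_orbit disk_coord(1)[symmetric] by auto
qed

section \<open>The corona of the great disk\<close>

text \<open>The coordinates of the vector with curvature m^2 + n^2 + 1, cocurvature m^2 + n^2 - 1
  and scaled center (m + i n)^2.\<close>

definition pair_vec :: "int \<Rightarrow> int \<Rightarrow> 4 \<Rightarrow> real" where
  "pair_vec m n = (\<lambda>i. real_of_int (
     if i = 1 then m\<^sup>2 + n\<^sup>2 - 1 - m * n
     else if i = 2 then m * (m - n)
     else if i = 3 then n * (n - m)
     else m * n))"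

lemma pair_vec_eqI:
  assumes "x 1 = of_int (m\<^sup>2 + n\<^sup>2 - 1 - m * n)" "x 2 = of_int (m * (m - n))"
    "x 3 = of_int (n * (n - m))" "x 4 = of_int (m * n)"
  shows "x = pair_vec m n"
proof
  fix i show "x i = pair_vec m n i"
    using exhaust_4[of i] assms by (auto simp: pair_vec_def)
qed

lemma reflect_pair_vec:
  "reflect 2 (pair_vec m n) = pair_vec m (2 * m - n)"
  "reflect 3 (pair_vec m n) = pair_vec (2 * n - m) n"
  "reflect 4 (pair_vec m n) = pair_vec m (- n)"
  by (rule pair_vec_eqI; simp add: reflect_def pair_vec_def power2_eq_square algebra_simps)+

text \<open>Opposite pairs give the same disk, the source of the halving in the area
  formula.\<close>

lemma pair_vec_uminus: "pair_vec (- m) (- n) = pair_vec m n"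
  by (rule pair_vec_eqI) (simp_all add: pair_vec_def algebra_simps)

lemma coord_eq_pair_vec:
  "coord 2 = pair_vec 1 0" "coord 3 = pair_vec 0 1" "coord 4 = pair_vec 1 1"
  by (rule pair_vec_eqI; simp)+

lemma gcd_reflect_pair:
  fixes m n :: int
  shows "gcd m (2 * m - n) = gcd m n"
proof -
  have "gcd m (2 * m - n) = gcd m (- (2 * m - n))" by (simp only: gcd_neg2)
  also have "- (2 * m - n) = (-2) * m + n" by simp
  also have "gcd m \<dots> = gcd m n" by (rule gcd_add_mult)
  finally show ?thesis .
qed

text \<open>The last reflection of a vector tangent to \<open>coord 1\<close> has index 2, 3 or 4,
  so the induction stays among such vectors; these reflections act on pairs and preserve the
  gcd.\<close>

lemma tangent_orbit_is_pair_vec: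
  assumes "x \<in> orbit" "descartes_form (coord 1) x = -1"
  shows "\<exists>m n. gcd m n = 1 \<and> x = pair_vec m n"
  using assms
proof (induction rule: orbit.induct)
  case (coord i)
  then have "i \<noteq> 1" by (auto simp: descartes_form_coord_coord)
  then consider "i = 2" | "i = 3" | "i = 4" using exhaust_4[of i] by blast
  then show ?case
    using coord_eq_pair_vec gcd_1_int[of 0] gcd_1_int[of 1] by cases (metis gcd.commute)+
next
  case (reflect x k)
  have k: "k \<noteq> 1" using orbit_tangent_reflect_index[OF reflect.hyps] reflect.prems by auto
  then have "descartes_form (coord 1) x = -1"
    using reflect.prems by (simp add: descartes_form_reflect[symmetric] reflect_coord)
  then have "\<exists>m n. gcd m n = 1 \<and> x = pair_vec m n" by (rule reflect.IH)
  then obtain m n where mn: "gcd m n = 1" "x = pair_vec m n" by (elim exE conjE)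
  consider "k = 2" | "k = 3" | "k = 4" using exhaust_4[of k] k by blast
  then show ?case
  proof cases
    case 1
    then show ?thesis using mn reflect_pair_vec(1) gcd_reflect_pair by metis
  next
    case 2
    then show ?thesis using mn reflect_pair_vec(2) gcd_reflect_pair[of n m] by (metis gcd.commute)
  next
    case 3
    then show ?thesis using mn reflect_pair_vec(3) by (metis gcd_neg2)
  qed
qed

text \<open>The reflections act on the pairs; descent on \<open>m\<^sup>2 + n\<^sup>2 - m n\<close>, which a reflection in a
  negative coordinate decreases.\<close>

lemma pair_vec_orbit:
  assumes "gcd m n = 1"
  shows "pair_vec m n \<in> orbit"
  using assms
proof (induction "nat (m\<^sup>2 + n\<^sup>2 - m * n)" arbitrary: m n rule: less_induct)
  case less
  have pos: "0 \<le> a\<^sup>2 + b\<^sup>2 - a * b" for a b :: int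
  proof -
    \<comment> \<open>The right-hand side is twice the quadratic form, written as a sum of
      squares.\<close>
    have "0 \<le> (a - b)\<^sup>2 + a\<^sup>2 + b\<^sup>2" by simp
    then show ?thesis by (simp add: power2_eq_square algebra_simps)
  qed
  have step: "pair_vec m n \<in> orbit"
    if "reflect k (pair_vec m n) = pair_vec a b" "gcd a b = 1"
      "a\<^sup>2 + b\<^sup>2 - a * b < m\<^sup>2 + n\<^sup>2 - m * n" for k a b
  proof -
    have "pair_vec a b \<in> orbit" using that pos[of a b] by (intro less.hyps) auto
    then show ?thesis using that(1) orbit_reflect_closed by (metis reflect_reflect)
  qed
  \<comment> \<open>These products are the coordinates 4, 2 and 3; reflecting in a negative one
    lowers the quadratic form by twice its absolute value.\<close>
  consider "m * n < 0" | "m * (m - n) < 0" | "n * (n - m) < 0"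
    | "m * n \<ge> 0" "m * (m - n) \<ge> 0" "n * (n - m) \<ge> 0" by linarith
  then show ?case
  proof cases
    case 1
    show ?thesis by (rule step[OF reflect_pair_vec(3)]) (use 1 less.prems in simp_all)
  next
    case 2
    have "gcd m (2 * m - n) = 1" using gcd_reflect_pair[of m n] less.prems by simp
    then show ?thesis
      by (rule step[OF reflect_pair_vec(1)])
        (use 2 in \<open>simp add: power2_eq_square algebra_simps\<close>)
  next
    case 3
    have "gcd (2 * n - m) n = 1" using gcd_reflect_pair[of n m] less.prems by (simp add: gcd.commute)
    then show ?thesis
      by (rule step[OF reflect_pair_vec(2)])
        (use 3 in \<open>simp add: power2_eq_square algebra_simps\<close>)
  next
    case 4
    \<comment> \<open>If both are nonzero they have the same sign, and the other two inequalities
      force \<open>m = n\<close>. Coprimality then leaves three unit vectors, each from two opposite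
      pairs.\<close>
    consider "m = 0" | "n = 0" | "m = n"
      using 4 by (smt (verit) mult_le_0_iff zero_le_mult_iff)
    then have "(m, n) \<in> {(0, 1), (0, -1), (1, 0), (-1, 0), (1, 1), (-1, -1)}"
      using less.prems by cases (auto simp: abs_if split: if_splits)
    then have "pair_vec m n \<in> {coord 2, coord 3, coord 4}"
      using pair_vec_uminus[of 1 0] pair_vec_uminus[of 0 1] pair_vec_uminus[of 1 1]
      by (auto simp: coord_eq_pair_vec)
    then show ?thesis using orbit.coord by auto
  qed
qed

lemma descartes_form_pair_vec: "descartes_form (coord 1) (pair_vec m n) = -1"
  by (simp add: descartes_form_coord sum_4 pair_vec_def power2_eq_square algebra_simps)

lemma corona_eq_pairs:
  "corona apollonian_window great_disk = (\<lambda>(m, n). disk (pair_vec m n)) ` {(m, n). gcd m n = 1}"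
proof -
  have "{x \<in> orbit. descartes_form (coord 1) x = -1} = (\<lambda>(m, n). pair_vec m n) ` {(m, n). gcd m n = 1}"
    using tangent_orbit_is_pair_vec pair_vec_orbit descartes_form_pair_vec
    by (auto simp: image_iff split_beta')
  then show ?thesis
    unfolding corona_eq_orbit by (simp add: image_image case_prod_unfold)
qed

section \<open>Curvature, center and area of the disk of a pair\<close>

lemma curvature_pair_vec: "curvature (pair_vec m n) = real_of_int (m\<^sup>2 + n\<^sup>2 + 1)"
  by (simp add: curvature_def pair_vec_def power2_eq_square algebra_simps)

lemma curvature_pair_vec_pos: "curvature (pair_vec m n) > 0"
proof -
  have "0 < m\<^sup>2 + n\<^sup>2 + 1" by (simp add: add_nonneg_pos)
  then show ?thesis unfolding curvature_pair_vec by (simp only: of_int_0_less_iff)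
qed

lemma scaled_center_pair_vec:
  "scaled_center (pair_vec m n) = Complex (real_of_int (m\<^sup>2 - n\<^sup>2)) (real_of_int (2 * m * n))"
  by (simp add: scaled_center_def pair_vec_def power2_eq_square algebra_simps)

lemma disk_pair_vec:
  assumes "gcd m n = 1"
  shows "disk (pair_vec m n) = cball (center (pair_vec m n)) (1 / curvature (pair_vec m n))"
  using assms by (intro disk_eq_cball orbit_norm pair_vec_orbit curvature_pair_vec_pos)

lemma measure_disk_pair_vec:
  assumes "gcd m n = 1"
  shows "measure lebesgue (disk (pair_vec m n)) = pi * (1 / (real_of_int (m\<^sup>2 + n\<^sup>2 + 1))\<^sup>2)"
proof -
  have r: "0 \<le> 1 / curvature (pair_vec m n)" using curvature_pair_vec_pos[of m n] by simp
  show ?thesis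
    unfolding disk_pair_vec[OF assms] using content_cball[OF r, of "center (pair_vec m n)"]
    by (simp add: unit_ball_vol_2 curvature_pair_vec power_divide)
qed

text \<open>Curvature and scaled center recover m^2 + n^2 and (m + i n)^2, which determine the pair
  up to sign.\<close>

lemma disk_pair_vec_eqD:
  assumes "gcd m n = 1" "gcd m' n' = 1" "disk (pair_vec m n) = disk (pair_vec m' n')"
  shows "m\<^sup>2 = m'\<^sup>2 \<and> n\<^sup>2 = n'\<^sup>2 \<and> m * n = m' * n'"
proof -
  note c = curvature_pair_vec_pos[of m n] curvature_pair_vec_pos[of m' n']
  have "center (pair_vec m n) = center (pair_vec m' n')"
    "curvature (pair_vec m n) = curvature (pair_vec m' n')"
    using assms(3) c unfolding disk_pair_vec[OF assms(1)] disk_pair_vec[OF assms(2)]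
    by (auto simp: cball_eq_cball_iff)
  then have "scaled_center (pair_vec m n) = scaled_center (pair_vec m' n')"
    "curvature (pair_vec m n) = curvature (pair_vec m' n')"
    using c scaled_center_eq by (metis less_irrefl)+
  then have "m\<^sup>2 - n\<^sup>2 = m'\<^sup>2 - n'\<^sup>2" "2 * m * n = 2 * m' * n'" "m\<^sup>2 + n\<^sup>2 + 1 = m'\<^sup>2 + n'\<^sup>2 + 1"
    unfolding curvature_pair_vec scaled_center_pair_vec complex.inject of_int_eq_iff by auto
  then show ?thesis by auto
qed

section \<open>The total area\<close>

lemma summable_int_inverse_square: "(\<lambda>k :: int. 1 / (real_of_int k ^ 2 + 1)) summable_on UNIV"
proof -
  have "summable (\<lambda>n. 1 / (real n ^ 2 + 1))"
  proof (rule summable_comparison_test'[where N = 1])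
    show "summable (\<lambda>n. inverse (real n ^ 2))" by (rule inverse_power_summable) simp
    show "norm (1 / (real n ^ 2 + 1)) \<le> inverse (real n ^ 2)" if "1 \<le> n" for n
      using that by (simp add: inverse_eq_divide frac_le)
  qed
  then have "(\<lambda>n. 1 / (real n ^ 2 + 1)) summable_on UNIV"
    by (subst summable_on_UNIV_nonneg_real_iff) simp_all
  \<comment> \<open>The integers are covered by two copies of the naturals, which overlap only in
    0.\<close>
  then have "(\<lambda>k :: int. 1 / (real_of_int k ^ 2 + 1)) summable_on range int"
    "(\<lambda>k :: int. 1 / (real_of_int k ^ 2 + 1)) summable_on range (\<lambda>n. - int n)"
    by (simp_all add: summable_on_reindex inj_on_def o_def)
  then have "(\<lambda>k :: int. 1 / (real_of_int k ^ 2 + 1)) summable_on (range int \<union> range (\<lambda>n. - int n))"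
    by (rule summable_on_union)
  moreover have "range int \<union> range (\<lambda>n. - int n) = UNIV"
  proof (intro equalityI subsetI)
    fix k :: int
    show "k \<in> range int \<union> range (\<lambda>n. - int n)" by (cases k rule: int_cases2) auto
  qed simp
  ultimately show ?thesis by simp
qed

text \<open>Comparison with a product of two one-variable series, since
  \<open>(a + 1) * (b + 1) \<le> (a + b + 1)\<^sup>2\<close> for nonnegative \<open>a\<close> and
  \<open>b\<close>.\<close>

lemma summable_pairs:
  "(\<lambda>(m, n). 1 / (real_of_int (m\<^sup>2 + n\<^sup>2 + 1))\<^sup>2) summable_on (UNIV :: (int \<times> int) set)"
proof (rule summable_on_comparison_test)
  let ?g = "\<lambda>k :: int. 1 / (real_of_int k ^ 2 + 1)"
  have "(\<lambda>(m, n). ?g m * ?g n) summable_on UNIV \<times> UNIV"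
  proof (rule summable_on_SigmaI[where g = "\<lambda>m. ?g m * infsum ?g UNIV"])
    show "((\<lambda>n. case (m, n) of (m, n) \<Rightarrow> ?g m * ?g n) has_sum ?g m * infsum ?g UNIV) UNIV" for m
      unfolding prod.case
      by (intro has_sum_cmult_right has_sum_infsum summable_int_inverse_square)
    show "(\<lambda>m. ?g m * infsum ?g UNIV) summable_on UNIV"
      by (intro summable_on_cmult_left summable_int_inverse_square)
  qed auto
  then show "(\<lambda>(m, n). ?g m * ?g n) summable_on UNIV" by simp
  show "(case p of (m, n) \<Rightarrow> 1 / (real_of_int (m\<^sup>2 + n\<^sup>2 + 1))\<^sup>2) \<le> (case p of (m, n) \<Rightarrow> ?g m * ?g n)"
    for p :: "int \<times> int"
  proof -
    obtain m n where p: "p = (m, n)" by fastforce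
    define a b where "a = (real_of_int m)\<^sup>2" and "b = (real_of_int n)\<^sup>2"
    have "0 \<le> a" "0 \<le> b" by (simp_all add: a_def b_def)
    then have "(a + 1) * (b + 1) \<le> (a + b + 1)\<^sup>2"
      by (simp add: power2_eq_square algebra_simps)
    then have "1 / (a + b + 1)\<^sup>2 \<le> 1 / ((a + 1) * (b + 1))"
      using \<open>0 \<le> a\<close> \<open>0 \<le> b\<close> by (intro divide_left_mono mult_pos_pos zero_less_power) auto
    then show ?thesis by (simp add: p a_def b_def)
  qed
qed auto

text \<open>The half contains one pair of each \<open>\<plusminus>(m, n)\<close>. Negation maps it
  onto the remaining coprime pairs, so by evenness both halves have equal sums.\<close>

lemma has_sum_half_coprime_pairs:
  fixes f :: "int \<times> int \<Rightarrow> real"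
  assumes "f summable_on {(m, n). gcd m n = 1}" and even: "\<And>m n. f (- m, - n) = f (m, n)"
  shows "(f has_sum (infsum f {(m, n). gcd m n = 1} / 2))
    {(m, n). gcd m n = 1 \<and> (0 < m \<or> m = 0 \<and> 0 < n)}"
proof -
  define C where "C = {(m :: int, n :: int). gcd m n = 1}"
  define H where "H = {(m :: int, n :: int). gcd m n = 1 \<and> (0 < m \<or> m = 0 \<and> 0 < n)}"
  define H' where "H' = (\<lambda>(m, n). (- m, - n)) ` H"
  have "C = H \<union> H'"
  proof (intro equalityI subsetI)
    fix p assume "p \<in> C"
    then obtain m n where p: "p = (m, n)" "gcd m n = 1" by (auto simp: C_def)
    have "m \<noteq> 0 \<or> n \<noteq> 0" using p by auto
    then have "p \<in> H \<or> (- m, - n) \<in> H" using p by (auto simp: H_def)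
    then show "p \<in> H \<union> H'" unfolding H'_def p(1) by force
  qed (auto simp: C_def H_def H'_def)
  have disj: "H \<inter> H' = {}" by (auto simp: H_def H'_def)
  have "f summable_on H" using assms(1) unfolding C_def[symmetric] \<open>C = H \<union> H'\<close>
    by (rule summable_on_subset) simp
  then have s: "(f has_sum infsum f H) H" by (rule has_sum_infsum)
  have "inj_on (\<lambda>(m :: int, n :: int). (- m, - n)) H" by (auto simp: inj_on_def)
  then have "(f has_sum infsum f H) H'"
    unfolding H'_def using s even by (simp add: has_sum_reindex o_def case_prod_unfold)
  then have "(f has_sum (infsum f H + infsum f H)) C"
    unfolding \<open>C = H \<union> H'\<close> using s disj by (intro has_sum_Un_disjoint)
  then have "infsum f C = 2 * infsum f H" using infsumI by fastforce
  then show ?thesis using s by (simp add: C_def H_def)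
qed

lemma bij_betw_half_pairs_corona:
  "bij_betw (\<lambda>(m, n). disk (pair_vec m n)) {(m, n). gcd m n = 1 \<and> (0 < m \<or> m = 0 \<and> 0 < n)}
    (corona apollonian_window great_disk)"
  unfolding bij_betw_def
proof
  show "inj_on (\<lambda>(m, n). disk (pair_vec m n)) {(m, n). gcd m n = 1 \<and> (0 < m \<or> m = 0 \<and> 0 < n)}"
  proof (rule inj_onI, goal_cases)
    case (1 p q)
    obtain m n m' n' where pq: "p = (m, n)" "q = (m', n')" by fastforce
    have g: "gcd m n = 1" "gcd m' n' = 1"
      and s: "0 < m \<or> m = 0 \<and> 0 < n" "0 < m' \<or> m' = 0 \<and> 0 < n'"
      and eq: "disk (pair_vec m n) = disk (pair_vec m' n')"
      using 1 unfolding pq by auto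
    have sq: "m\<^sup>2 = m'\<^sup>2" "n\<^sup>2 = n'\<^sup>2" "m * n = m' * n'"
      using disk_pair_vec_eqD[OF g eq] by auto
    have "m = m'" using sq(1) s by (auto simp: power2_eq_iff)
    \<comment> \<open>For \<open>m > 0\<close> the product fixes the sign of \<open>n\<close>; for
      \<open>m = 0\<close> both \<open>n\<close> and \<open>n'\<close> are positive by the choice of
      the half.\<close>
    moreover have "n = n'" using sq s \<open>m = m'\<close> by (auto simp: power2_eq_iff)
    ultimately show ?case by (simp add: pq)
  qed
  show "(\<lambda>(m, n). disk (pair_vec m n)) ` {(m, n). gcd m n = 1 \<and> (0 < m \<or> m = 0 \<and> 0 < n)}
    = corona apollonian_window great_disk"
  proof (intro equalityI subsetI)
    fix D assume "D \<in> corona apollonian_window great_disk"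
    then obtain m n where D: "coprime m n" "D = disk (pair_vec m n)"
      unfolding corona_eq_pairs by auto
    have "m \<noteq> 0 \<or> n \<noteq> 0" using D by auto
    then have "(0 < m \<or> m = 0 \<and> 0 < n) \<or> (0 < - m \<or> - m = 0 \<and> 0 < - n)" by auto
    then show "D \<in> (\<lambda>(m, n). disk (pair_vec m n)) `
        {(m, n). gcd m n = 1 \<and> (0 < m \<or> m = 0 \<and> 0 < n)}"
    proof
      assume "0 < m \<or> m = 0 \<and> 0 < n"
      then show ?thesis using D by auto
    next
      assume "0 < - m \<or> - m = 0 \<and> 0 < - n"
      then show ?thesis using D pair_vec_uminus[of m n]
        by (intro image_eqI[of _ _ "(- m, - n)"]) auto
    qed
  qed (auto simp: corona_eq_pairs)
qed

theorem proposition3p2: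
  "(\<lambda>(m, n). 1 / (real_of_int (m^2 + n^2 + 1))^2) summable_on {(m :: int, n :: int). gcd m n = 1} \<and>
   (measure lebesgue has_sum
      (pi / 2 * (\<Sum>\<^sub>\<infinity>(m, n)\<in>{(m :: int, n :: int). gcd m n = 1}.
                    1 / (real_of_int (m^2 + n^2 + 1))^2)))
     (corona apollonian_window great_disk)"
proof
  let ?f = "\<lambda>(m, n). 1 / (real_of_int (m\<^sup>2 + n\<^sup>2 + 1))\<^sup>2"
  let ?C = "{(m :: int, n :: int). gcd m n = 1}"
  let ?H = "{(m :: int, n :: int). gcd m n = 1 \<and> (0 < m \<or> m = 0 \<and> 0 < n)}"
  show sum: "?f summable_on ?C"
    using summable_pairs by (rule summable_on_subset) simp
  \<comment> \<open>Over this half every disk of the corona is counted exactly once.\<close>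
  have "(?f has_sum (infsum ?f ?C / 2)) ?H"
    using sum by (rule has_sum_half_coprime_pairs) simp
  then have "((\<lambda>p. pi * ?f p) has_sum (pi * (infsum ?f ?C / 2))) ?H"
    by (rule has_sum_cmult_right)
  also have "?this \<longleftrightarrow> ((\<lambda>p. measure lebesgue (case p of (m, n) \<Rightarrow> disk (pair_vec m n)))
      has_sum (pi * (infsum ?f ?C / 2))) ?H"
    by (intro has_sum_cong) (auto simp: measure_disk_pair_vec)
  finally have "(measure lebesgue has_sum (pi * (infsum ?f ?C / 2))) (corona apollonian_window great_disk)"
    by (subst (asm) has_sum_reindex_bij_betw[OF bij_betw_half_pairs_corona])
  then show "(measure lebesgue has_sum (pi / 2 * infsum ?f ?C)) (corona apollonian_window great_disk)"
    by simp
qed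

end
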